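(* For all finite sets $\Gamma$ of formulas, all finite multisets $\Delta$ of formulas and every formula $A$: if the sequent $\Gamma;\Delta \vdash A$ is derivable, then $(\Gamma;A) \preceq_s (\Gamma;\Delta)$, where $(\Gamma;A)$ denotes the state with unrestricted part $\Gamma$ and linear part the single formula $A$.
   Context: Formulas: $A,B,C ::= a \mid \mathbf{1} \mid A\otimes B \mid \top \mid A \,\&\, B \mid a \multimap B \mid\ !A$, with $a$ ranging over atomic formulas (the antecedent of $\multimap$ is always atomic). Contexts $\Gamma,\Delta$ are finite multisets of formulas; "$\Delta_1,\Delta_2$" is multiset union, "$\cdot$" the empty context. Sequents $\Gamma;\Delta\vdash A$ are derivable by the following rules (premises before "infer"): (init) $\Gamma;a\vdash a$. (clone) from $\Gamma,A;\Delta,A\vdash C$ infer $\Gamma,A;\Delta\vdash C$. ($\otimes$R) from $\Gamma;\Delta_1\vdash A$ and $\Gamma;\Delta_2\vdash B$ infer $\Gamma;\Delta_1,\Delta_2\vdash A\otimes B$. ($\otimes$L) from $\Gamma;\Delta,A,B\vdash C$ infer $\Gamma;\Delta,A\otimes B\vdash C$. ($\mathbf 1$R) $\Gamma;\cdot\vdash\mathbf 1$. ($\mathbf 1$L) from $\Gamma;\Delta\vdash C$ infer $\Gamma;\Delta,\mathbf 1\vdash C$. ($\&$R) from $\Gamma;\Delta\vdash A$ and $\Gamma;\Delta\vdash B$ infer $\Gamma;\Delta\vdash A\&B$. ($\&$L$_i$, $i=1,2$) from $\Gamma;\Delta,A_i\vdash C$ infer $\Gamma;\Delta,A_1\&A_2\vdash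 C$. ($\top$R) $\Gamma;\Delta\vdash\top$ (there is no left rule for $\top$). ($\multimap$R) from $\Gamma;\Delta,a\vdash B$ infer $\Gamma;\Delta\vdash a\multimap B$. ($\multimap$L) from $\Gamma;\Delta_1\vdash a$ and $\Gamma;\Delta_2,B\vdash C$ infer $\Gamma;\Delta_1,\Delta_2,a\multimap B\vdash C$. (!R) from $\Gamma;\cdot\vdash A$ infer $\Gamma;\cdot\vdash\,!A$. (!L) from $\Gamma,A;\Delta\vdash C$ infer $\Gamma;\Delta,!A\vdash C$. States are pairs $(\Gamma;\Delta)$ considered modulo structural congruence $\equiv$: $\Delta$ is a multiset and $\Gamma$ is a set (i.e. additionally $(\Gamma,A,A;\Delta)\equiv(\Gamma,A;\Delta)$); congruent states are identified. The composition of states is $((\Gamma_1;\Delta_1),(\Gamma_2;\Delta_2)) := (\Gamma_1,\Gamma_2;\Delta_1,\Delta_2)$. Labelled transitions $S\xrightarrow{\beta}S'$ between states, with labels $\beta\in\{\tau\}\cup\{!a\}\cup\{?a\}$ ($a$ atomic), are generated by: $(\Gamma;\Delta,a)\xrightarrow{!a}(\Gamma;\Delta)$; $(\Gamma;\Delta,a\multimap B)\xrightarrow{?a}(\Gamma;\Delta,B)$; if $S_1\xrightarrow{!a}S_1'$ and $S_2\xrightarrow{?a}S_2'$ then $(S_1,S_2)\xrightarrow{\tau}(S_1',S_2')$; $(\Gamma;\Delta,A\otimes B)\xrightarrow{\tau}(\Gamma;\Delta,A,B)$; $(\Gamma;\Delta,\mathbf 1)\xrightarrow{\tau}(\Gamma;\Delta)$;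 $(\Gamma;\Delta,A_1\&A_2)\xrightarrow{\tau}(\Gamma;\Delta,A_i)$ for $i=1,2$; $(\Gamma;\Delta,!A)\xrightarrow{\tau}(\Gamma,A;\Delta)$; $(\Gamma,A;\Delta)\xrightarrow{\tau}(\Gamma,A;\Delta,A)$ (no rule for $\top$). Let $\alpha$ range over non-receive labels ($\tau$ or $!a$). $\overset{\tau}{\Longrightarrow}$ is the reflexive transitive closure of $\xrightarrow{\tau}$, and for $\beta\neq\tau$, $\overset{\beta}{\Longrightarrow}$ is $\overset{\tau}{\Longrightarrow}\xrightarrow{\beta}\overset{\tau}{\Longrightarrow}$. A relation $\mathcal R$ on states is a simulation if $(\Gamma_1;\Delta_1)\mathcal R(\Gamma_2;\Delta_2)$ implies: (1) if $(\Gamma_1;\Delta_1)\equiv(\Gamma_1';\cdot)$ then $(\Gamma_2;\Delta_2)\overset{\tau}{\Longrightarrow}(\Gamma_2';\cdot)$ for some $\Gamma_2'$ with $(\Gamma_1';\cdot)\mathcal R(\Gamma_2';\cdot)$; (2) if $(\Gamma_1;\Delta_1)\equiv((\Gamma_1';\Delta_1'),(\Gamma_1'';\Delta_1''))$ then $(\Gamma_2;\Delta_2)\overset{\tau}{\Longrightarrow}((\Gamma_2';\Delta_2'),(\Gamma_2'';\Delta_2''))$ for some states with $(\Gamma_1';\Delta_1')\mathcal R(\Gamma_2';\Delta_2')$ and $(\Gamma_1'';\Delta_1'')\mathcal R(\Gamma_2'';\Delta_2'')$; (3) if $(\Gamma_1;\Delta_1)\xrightarrow{\alpha}(\Gamma_1';\Delta_1')$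 then $(\Gamma_2;\Delta_2)\overset{\alpha}{\Longrightarrow}(\Gamma_2';\Delta_2')$ for some state with $(\Gamma_1';\Delta_1')\mathcal R(\Gamma_2';\Delta_2')$; (4) if $(\Gamma_1;\Delta_1)\xrightarrow{?a}(\Gamma_1';\Delta_1')$ then $(\Gamma_2;\Delta_2,a)\overset{\tau}{\Longrightarrow}(\Gamma_2';\Delta_2')$ for some state with $(\Gamma_1';\Delta_1')\mathcal R(\Gamma_2';\Delta_2')$. The simulation preorder $\preceq_s$ is the union of all simulations: $S_1\preceq_s S_2$ iff some simulation relates $S_1$ to $S_2$. *)

theory Defs
  imports "HOL-Library.Multiset" "HOL-Library.FSet"
begin

datatype 'a fm =
    Atom 'a
  | One
  | Tensor "'a fm" "'a fm"
  | Top
  | With "'a fm" "'a fm"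
  | Lolli 'a "'a fm"
  | Bang "'a fm"

inductive derivable :: "'a fm multiset \<Rightarrow> 'a fm multiset \<Rightarrow> 'a fm \<Rightarrow> bool" where
  init: "derivable \<Gamma> {#Atom a#} (Atom a)"
| clone: "derivable (add_mset A \<Gamma>) (add_mset A \<Delta>) C \<Longrightarrow> derivable (add_mset A \<Gamma>) \<Delta> C"
| tensorR: "derivable \<Gamma> \<Delta>\<^sub>1 A \<Longrightarrow> derivable \<Gamma> \<Delta>\<^sub>2 B \<Longrightarrow> derivable \<Gamma> (\<Delta>\<^sub>1 + \<Delta>\<^sub>2) (Tensor A B)"
| tensorL: "derivable \<Gamma> (\<Delta> + {#A, B#}) C \<Longrightarrow> derivable \<Gamma> (add_mset (Tensor A B) \<Delta>) C"
| oneR: "derivable \<Gamma> {#} One"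
| oneL: "derivable \<Gamma> \<Delta> C \<Longrightarrow> derivable \<Gamma> (add_mset One \<Delta>) C"
| withR: "derivable \<Gamma> \<Delta> A \<Longrightarrow> derivable \<Gamma> \<Delta> B \<Longrightarrow> derivable \<Gamma> \<Delta> (With A B)"
| withL1: "derivable \<Gamma> (add_mset A \<Delta>) C \<Longrightarrow> derivable \<Gamma> (add_mset (With A B) \<Delta>) C"
| withL2: "derivable \<Gamma> (add_mset B \<Delta>) C \<Longrightarrow> derivable \<Gamma> (add_mset (With A B) \<Delta>) C"
| topR: "derivable \<Gamma> \<Delta> Top"
| lolliR: "derivable \<Gamma> (add_mset (Atom a) \<Delta>) B \<Longrightarrow> derivable \<Gamma> \<Delta> (Lolli a B)"
| lolliL: "derivable \<Gamma> \<Delta>\<^sub>1 (Atom a) \<Longrightarrow> derivable \<Gamma> (add_mset B \<Delta>\<^sub>2) C \<Longrightarrow>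
    derivable \<Gamma> (add_mset (Lolli a B) (\<Delta>\<^sub>1 + \<Delta>\<^sub>2)) C"
| bangR: "derivable \<Gamma> {#} A \<Longrightarrow> derivable \<Gamma> {#} (Bang A)"
| bangL: "derivable (add_mset A \<Gamma>) \<Delta> C \<Longrightarrow> derivable \<Gamma> (add_mset (Bang A) \<Delta>) C"

text \<open>States modulo structural congruence: the unrestricted part is a finite set and the
  linear part a multiset, so congruence of states is equality.\<close>

type_synonym 'a state = "'a fm fset \<times> 'a fm multiset"

definition compose :: "'a state \<Rightarrow> 'a state \<Rightarrow> 'a state" where
  "compose S\<^sub>1 S\<^sub>2 = (fst S\<^sub>1 |\<union>| fst S\<^sub>2, snd S\<^sub>1 + snd S\<^sub>2)"

datatype 'a label = Tau | Send 'a | Recv 'a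

inductive step :: "'a state \<Rightarrow> 'a label \<Rightarrow> 'a state \<Rightarrow> bool" where
  send: "step (\<Gamma>, add_mset (Atom a) \<Delta>) (Send a) (\<Gamma>, \<Delta>)"
| recv: "step (\<Gamma>, add_mset (Lolli a B) \<Delta>) (Recv a) (\<Gamma>, add_mset B \<Delta>)"
| comm: "step S\<^sub>1 (Send a) S\<^sub>1' \<Longrightarrow> step S\<^sub>2 (Recv a) S\<^sub>2' \<Longrightarrow>
    step (compose S\<^sub>1 S\<^sub>2) Tau (compose S\<^sub>1' S\<^sub>2')"
| tensor: "step (\<Gamma>, add_mset (Tensor A B) \<Delta>) Tau (\<Gamma>, \<Delta> + {#A, B#})"
| one: "step (\<Gamma>, add_mset One \<Delta>) Tau (\<Gamma>, \<Delta>)"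
| with1: "step (\<Gamma>, add_mset (With A B) \<Delta>) Tau (\<Gamma>, add_mset A \<Delta>)"
| with2: "step (\<Gamma>, add_mset (With A B) \<Delta>) Tau (\<Gamma>, add_mset B \<Delta>)"
| bang: "step (\<Gamma>, add_mset (Bang A) \<Delta>) Tau (finsert A \<Gamma>, \<Delta>)"
| clone: "step (finsert A \<Gamma>, \<Delta>) Tau (finsert A \<Gamma>, add_mset A \<Delta>)"

definition tau_steps :: "'a state \<Rightarrow> 'a state \<Rightarrow> bool" where
  "tau_steps = (\<lambda>S S'. step S Tau S')\<^sup>*\<^sup>*"

definition weak_step :: "'a state \<Rightarrow> 'a label \<Rightarrow> 'a state \<Rightarrow> bool" where
  "weak_step S \<beta> S' \<longleftrightarrow>
    (if \<beta> = Tau then tau_steps S S'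
     else \<exists>T T'. tau_steps S T \<and> step T \<beta> T' \<and> tau_steps T' S')"

definition simulation :: "('a state \<Rightarrow> 'a state \<Rightarrow> bool) \<Rightarrow> bool" where
  "simulation R \<longleftrightarrow> (\<forall>\<Gamma>\<^sub>1 \<Delta>\<^sub>1 \<Gamma>\<^sub>2 \<Delta>\<^sub>2. R (\<Gamma>\<^sub>1, \<Delta>\<^sub>1) (\<Gamma>\<^sub>2, \<Delta>\<^sub>2) \<longrightarrow>
    (\<forall>\<Gamma>\<^sub>1'. (\<Gamma>\<^sub>1, \<Delta>\<^sub>1) = (\<Gamma>\<^sub>1', {#}) \<longrightarrow>
      (\<exists>\<Gamma>\<^sub>2'. weak_step (\<Gamma>\<^sub>2, \<Delta>\<^sub>2) Tau (\<Gamma>\<^sub>2', {#}) \<and> R (\<Gamma>\<^sub>1', {#}) (\<Gamma>\<^sub>2', {#}))) \<and>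
    (\<forall>S\<^sub>1' S\<^sub>1''. (\<Gamma>\<^sub>1, \<Delta>\<^sub>1) = compose S\<^sub>1' S\<^sub>1'' \<longrightarrow>
      (\<exists>S\<^sub>2' S\<^sub>2''. weak_step (\<Gamma>\<^sub>2, \<Delta>\<^sub>2) Tau (compose S\<^sub>2' S\<^sub>2'') \<and> R S\<^sub>1' S\<^sub>2' \<and> R S\<^sub>1'' S\<^sub>2'')) \<and>
    (\<forall>\<alpha> S\<^sub>1'. (\<forall>a. \<alpha> \<noteq> Recv a) \<longrightarrow> step (\<Gamma>\<^sub>1, \<Delta>\<^sub>1) \<alpha> S\<^sub>1' \<longrightarrow>
      (\<exists>S\<^sub>2'. weak_step (\<Gamma>\<^sub>2, \<Delta>\<^sub>2) \<alpha> S\<^sub>2' \<and> R S\<^sub>1' S\<^sub>2')) \<and>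
    (\<forall>a S\<^sub>1'. step (\<Gamma>\<^sub>1, \<Delta>\<^sub>1) (Recv a) S\<^sub>1' \<longrightarrow>
      (\<exists>S\<^sub>2'. weak_step (\<Gamma>\<^sub>2, add_mset (Atom a) \<Delta>\<^sub>2) Tau S\<^sub>2' \<and> R S\<^sub>1' S\<^sub>2')))"

definition sim_preorder :: "'a state \<Rightarrow> 'a state \<Rightarrow> bool" (infix "\<preceq>\<^sub>s" 50) where
  "S\<^sub>1 \<preceq>\<^sub>s S\<^sub>2 \<longleftrightarrow> (\<exists>R. simulation R \<and> R S\<^sub>1 S\<^sub>2)"

end

theory Submission
  imports Defs
begin

text \<open>Read backwards, each left rule is a silent transition of the antecedent. Hence a derivation
  of \<open>\<Gamma>; \<Delta> \<turnstile> A\<close> lets the state \<open>(\<Gamma>; \<Delta>)\<close> evolve silently until the last rule of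
  the remaining derivation introduces \<open>A\<close> on the right. It follows that a simulation is obtained by
  relating \<open>(\<Gamma>\<^sub>1; A\<^sub>1, \<dots>, A\<^sub>n)\<close> to \<open>(\<Gamma>\<^sub>2; \<Delta>\<^sub>2)\<close> whenever \<open>\<Gamma>\<^sub>2; \<cdot> \<turnstile> B\<close> for all
  \<open>B\<close> in \<open>\<Gamma>\<^sub>1\<close> and \<open>\<Delta>\<^sub>2\<close> splits into parts \<open>D\<^sub>1, \<dots>, D\<^sub>n\<close> with
  \<open>\<Gamma>\<^sub>2; D\<^sub>i \<turnstile> A\<^sub>i\<close>. No cut elimination is needed.\<close>

section \<open>Weakening and identity in the sequent calculus\<close>

text \<open>The rules consult the unrestricted context only through membership, so only its support
  matters. This bridges the multisets of \<open>derivable\<close> and the finite sets of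
  states.\<close>

lemma derivable_mono:
  assumes "derivable \<Gamma> \<Delta> A" "set_mset \<Gamma> \<subseteq> set_mset \<Gamma>'"
  shows "derivable \<Gamma>' \<Delta> A"
  using assms
proof (induction arbitrary: \<Gamma>' rule: derivable.induct)
  case (clone A \<Gamma> \<Delta> C)
  then obtain \<Gamma>'' where "\<Gamma>' = add_mset A \<Gamma>''"
    using mset_add[of A \<Gamma>'] by auto
  with clone show ?case
    by (metis derivable.clone)
next
  case (bangL A \<Gamma> \<Delta> C)
  from bangL.IH[of "add_mset A \<Gamma>'"] bangL.prems show ?case
    by (intro derivable.bangL) auto
qed (auto intro: derivable.intros)

text \<open>Identity expansion: \<open>init\<close> covers atoms only, and each connective reduces
  the claim to its components.\<close>

lemma derivable_refl: "derivable \<Gamma> {#A#} A"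
proof (induction A arbitrary: \<Gamma>)
  case (Tensor A B)
  have "derivable \<Gamma> ({#A#} + {#B#}) (Tensor A B)"
    by (intro derivable.tensorR Tensor)
  then show ?case
    using derivable.tensorL[of \<Gamma> "{#}" A B] by (simp add: add_mset_commute)
next
  case One
  show ?case
    by (intro derivable.oneL derivable.oneR)
next
  case (Lolli a B)
  have "derivable \<Gamma> (add_mset (Lolli a B) ({#Atom a#} + {#})) B"
    by (intro derivable.lolliL derivable.init Lolli)
  then show ?case
    by (intro derivable.lolliR) (simp add: add_mset_commute)
next
  case (Bang A)
  show ?case
    by (rule derivable.bangL, rule derivable.bangR, rule derivable.clone, rule Bang)
qed (auto intro: derivable.intros)

definition entails :: "'a fm fset \<Rightarrow> 'a fm multiset \<Rightarrow> 'a fm \<Rightarrow> bool" where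
  "entails G D A \<longleftrightarrow> derivable (mset_set (fset G)) D A"

lemma entails_if_derivable:
  "derivable \<Gamma> D A \<Longrightarrow> set_mset \<Gamma> \<subseteq> fset G \<Longrightarrow> entails G D A"
  unfolding entails_def by (erule derivable_mono) simp

lemma entails_mono: "entails G D A \<Longrightarrow> G |\<subseteq>| H \<Longrightarrow> entails H D A"
  unfolding entails_def by (erule derivable_mono) (simp add: less_eq_fset.rep_eq)

lemma entails_unrestricted:
  assumes "A |\<in>| G"
  shows "entails G {#} A"
proof -
  have "derivable {#A#} {#} A"
    by (rule derivable.clone[OF derivable_refl])
  then show ?thesis
    by (rule entails_if_derivable) (simp add: assms)
qed

section \<open>Transitions under composition\<close>

lemma tau_steps_refl: "tau_steps S S"
  by (simp add: tau_steps_def)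

lemma tau_steps_trans: "tau_steps S T \<Longrightarrow> tau_steps T U \<Longrightarrow> tau_steps S U"
  unfolding tau_steps_def by (rule rtranclp_trans)

lemma tau_steps_step: "step S Tau T \<Longrightarrow> tau_steps T U \<Longrightarrow> tau_steps S U"
  unfolding tau_steps_def by (rule converse_rtranclp_into_rtranclp)

lemma compose_assoc: "compose (compose S T) U = compose S (compose T U)"
  by (simp add: compose_def ac_simps sup_assoc)

text \<open>Every transition is local. For a communication, associativity moves the frame
  \<open>T\<close> to the receiver, where the induction hypothesis applies.\<close>

lemma step_frame: "step S l S' \<Longrightarrow> step (compose S T) l (compose S' T)"
proof (induction rule: step.induct)
  case (comm S\<^sub>1 a S\<^sub>1' S\<^sub>2 S\<^sub>2')
  then show ?case
    by (simp only: compose_assoc) (rule step.comm)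
next
  case (tensor \<Gamma> A B \<Delta>)
  then show ?case
    using step.tensor[of "\<Gamma> |\<union>| fst T" A B "\<Delta> + snd T"] by (simp add: compose_def)
qed (auto simp: compose_def intro: step.intros)

lemma tau_steps_frame: "tau_steps S S' \<Longrightarrow> tau_steps (compose S T) (compose S' T)"
  unfolding tau_steps_def
  by (induction rule: rtranclp_induct) (auto intro: rtranclp.rtrancl_into_rtrancl step_frame)

lemma step_unrestricted_mono: "step S l S' \<Longrightarrow> fst S |\<subseteq>| fst S'"
  by (induction rule: step.induct) (auto simp: compose_def)

lemma tau_steps_unrestricted_mono: "tau_steps S S' \<Longrightarrow> fst S |\<subseteq>| fst S'"
  unfolding tau_steps_def
  by (induction rule: rtranclp_induct) (auto dest: step_unrestricted_mono)

lemma tau_steps_add_linear: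
  assumes "tau_steps (G, D) (G', D')"
  shows "tau_steps (G, D + E) (G', D' + E)"
  using tau_steps_frame[OF assms, of "({||}, E)"] by (simp add: compose_def)

text \<open>The sender is the atom alone and the receiver is the rest. Both carry all of
  \<open>G\<close>, since union of sets is idempotent.\<close>

lemma step_comm_single:
  "step (G, add_mset (Atom a) (add_mset (Lolli a B) D)) Tau (G, add_mset B D)"
  using step.comm[OF step.send[of G a "{#}"] step.recv[of G a B D]]
  by (simp add: compose_def add_mset_commute)

section \<open>Reaching a right rule by silent transitions\<close>

text \<open>Derivability by a derivation ending with the right rule (or \<open>init\<close>) for the succedent.\<close>

fun right_entails :: "'a fm fset \<Rightarrow> 'a fm multiset \<Rightarrow> 'a fm \<Rightarrow> bool" where
  "right_entails G D (Atom a) \<longleftrightarrow> D = {#Atom a#}"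
| "right_entails G D One \<longleftrightarrow> D = {#}"
| "right_entails G D (Tensor A B) \<longleftrightarrow> (\<exists>D\<^sub>1 D\<^sub>2. D = D\<^sub>1 + D\<^sub>2 \<and> entails G D\<^sub>1 A \<and> entails G D\<^sub>2 B)"
| "right_entails G D Top \<longleftrightarrow> True"
| "right_entails G D (With A B) \<longleftrightarrow> entails G D A \<and> entails G D B"
| "right_entails G D (Lolli a B) \<longleftrightarrow> entails G (add_mset (Atom a) D) B"
| "right_entails G D (Bang A) \<longleftrightarrow> D = {#} \<and> entails G {#} A"

definition reaches_right :: "'a fm fset \<Rightarrow> 'a fm multiset \<Rightarrow> 'a fm \<Rightarrow> bool" where
  "reaches_right G D A \<longleftrightarrow> (\<exists>G' D'. tau_steps (G, D) (G', D') \<and> right_entails G' D' A)"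

lemma reaches_right_if_right: "right_entails G D A \<Longrightarrow> reaches_right G D A"
  unfolding reaches_right_def using tau_steps_refl by blast

lemma reaches_right_steps:
  "tau_steps (G, D) (G', D') \<Longrightarrow> reaches_right G' D' A \<Longrightarrow> reaches_right G D A"
  unfolding reaches_right_def using tau_steps_trans by blast

lemma reaches_right_step:
  "step (G, D) Tau (G', D') \<Longrightarrow> reaches_right G' D' A \<Longrightarrow> reaches_right G D A"
  unfolding reaches_right_def using tau_steps_step by blast

text \<open>Induction on the derivation. \<open>G\<close> may exceed the support of \<Gamma> because
  the transitions that match \<open>bangL\<close> and the left premise of \<open>lolliL\<close>
  enlarge it.\<close>

lemma derivable_reaches_right:
  assumes "derivable \<Gamma> D C" "set_mset \<Gamma> \<subseteq> fset G"
  shows "reaches_right G D C"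
  using assms
proof (induction arbitrary: G rule: derivable.induct)
  case (clone A \<Gamma> \<Delta> C)
  then have "G = finsert A G" by auto
  then have "step (G, \<Delta>) Tau (G, add_mset A \<Delta>)"
    by (metis step.clone)
  with clone show ?case
    by (blast intro: reaches_right_step)
next
  case (lolliL \<Gamma> \<Delta>\<^sub>1 a B \<Delta>\<^sub>2 C)
  \<comment> \<open>At an atom, \<open>right_entails\<close> leaves exactly that atom as linear
    part, ready to be consumed by the implication.\<close>
  then obtain G' where G': "tau_steps (G, \<Delta>\<^sub>1) (G', {#Atom a#})"
    unfolding reaches_right_def by fastforce
  have "tau_steps (G, add_mset (Lolli a B) (\<Delta>\<^sub>1 + \<Delta>\<^sub>2))
      (G', add_mset (Atom a) (add_mset (Lolli a B) \<Delta>\<^sub>2))"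
    using tau_steps_add_linear[OF G', of "add_mset (Lolli a B) \<Delta>\<^sub>2"]
    by (simp add: add_mset_commute)
  moreover have "reaches_right G' (add_mset B \<Delta>\<^sub>2) C"
    using lolliL.IH(2)[of G'] lolliL.prems tau_steps_unrestricted_mono[OF G']
    by (auto simp: less_eq_fset.rep_eq)
  ultimately show ?case
    by (meson reaches_right_steps reaches_right_step step_comm_single)
next
  case (bangL A \<Gamma> \<Delta> C)
  then have "reaches_right (finsert A G) \<Delta> C"
    by auto
  then show ?case
    by (rule reaches_right_step[OF step.bang])
next
  case (tensorR \<Gamma> \<Delta>\<^sub>1 A \<Delta>\<^sub>2 B)
  then show ?case
    by (intro reaches_right_if_right) (auto intro: entails_if_derivable)
next
  case withR
  then show ?case
    by (intro reaches_right_if_right) (auto intro: entails_if_derivable)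
next
  case lolliR
  then show ?case
    by (intro reaches_right_if_right) (auto intro: entails_if_derivable)
next
  case bangR
  then show ?case
    by (intro reaches_right_if_right) (auto intro: entails_if_derivable)
qed (auto intro: reaches_right_if_right entails_if_derivable reaches_right_step step.intros)

section \<open>Distributing a linear context over several formulas\<close>

text \<open>The inductive form keeps the partition into parts implicit and avoids indexing
  them.\<close>

inductive entails_all :: "'a fm fset \<Rightarrow> 'a fm multiset \<Rightarrow> 'a fm multiset \<Rightarrow> bool" for G where
  empty: "entails_all G {#} {#}"
| add: "entails G D A \<Longrightarrow> entails_all G E M \<Longrightarrow> entails_all G (D + E) (add_mset A M)"

lemma entails_all_mono: "entails_all G D M \<Longrightarrow> G |\<subseteq>| H \<Longrightarrow> entails_all H D M"
  by (induction rule: entails_all.induct) (auto intro: entails_all.intros entails_mono)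

lemma entails_all_empty: "entails_all G D {#} \<Longrightarrow> D = {#}"
  by (auto elim: entails_all.cases)

lemma entails_all_single: "entails G D A \<Longrightarrow> entails_all G D {#A#}"
  using entails_all.add[OF _ entails_all.empty] by fastforce

text \<open>Each part goes to the side that holds its formula; if the formula occurs on both sides,
  either choice works.\<close>

lemma entails_all_split:
  assumes "entails_all G D (M\<^sub>1 + M\<^sub>2)"
  shows "\<exists>D\<^sub>1 D\<^sub>2. D = D\<^sub>1 + D\<^sub>2 \<and> entails_all G D\<^sub>1 M\<^sub>1 \<and> entails_all G D\<^sub>2 M\<^sub>2"
  using assms
proof (induction D "M\<^sub>1 + M\<^sub>2" arbitrary: M\<^sub>1 M\<^sub>2 rule: entails_all.induct)
  case empty
  then show ?case
    using entails_all.empty by auto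
next
  case (add D A E M)
  from add.hyps(4) have "A \<in># M\<^sub>1 \<or> A \<in># M\<^sub>2"
    by (metis union_iff union_single_eq_member)
  then show ?case
  proof
    assume "A \<in># M\<^sub>1"
    then obtain N where N: "M\<^sub>1 = add_mset A N"
      by (metis insert_DiffM)
    with add.hyps(4) have "M = N + M\<^sub>2" by simp
    from add.hyps(3)[OF this] obtain D\<^sub>1 D\<^sub>2 where
      "E = D\<^sub>1 + D\<^sub>2" "entails_all G D\<^sub>1 N" "entails_all G D\<^sub>2 M\<^sub>2" by blast
    with add.hyps(1) N have "D + E = (D + D\<^sub>1) + D\<^sub>2" "entails_all G (D + D\<^sub>1) M\<^sub>1"
      by (auto intro: entails_all.add)
    with \<open>entails_all G D\<^sub>2 M\<^sub>2\<close> show ?thesis by blast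
  next
    assume "A \<in># M\<^sub>2"
    then obtain N where N: "M\<^sub>2 = add_mset A N"
      by (metis insert_DiffM)
    with add.hyps(4) have "M = M\<^sub>1 + N" by simp
    from add.hyps(3)[OF this] obtain D\<^sub>1 D\<^sub>2 where
      "E = D\<^sub>1 + D\<^sub>2" "entails_all G D\<^sub>1 M\<^sub>1" "entails_all G D\<^sub>2 N" by blast
    with add.hyps(1) N have "D + E = D\<^sub>1 + (D + D\<^sub>2)" "entails_all G (D + D\<^sub>2) M\<^sub>2"
      by (auto intro: entails_all.add)
    with \<open>entails_all G D\<^sub>1 M\<^sub>1\<close> show ?thesis by blast
  qed
qed

text \<open>Direct inversion could single out another formula of the multiset. Splitting off
  \<open>{#A#}\<close> first forces it to be \<open>A\<close>.\<close>

lemma entails_all_remove: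
  assumes "entails_all G D (add_mset A M)"
  obtains D\<^sub>1 D\<^sub>2 where "D = D\<^sub>1 + D\<^sub>2" "entails G D\<^sub>1 A" "entails_all G D\<^sub>2 M"
proof -
  from entails_all_split[of G D "{#A#}" M] assms obtain D\<^sub>1 D\<^sub>2 where
    *: "D = D\<^sub>1 + D\<^sub>2" "entails_all G D\<^sub>1 {#A#}" "entails_all G D\<^sub>2 M" by auto
  from *(2) have "entails G D\<^sub>1 A"
    by cases (auto dest: entails_all_empty)
  with * that show ?thesis by blast
qed

text \<open>Only the part assigned to \<open>A\<close> evolves. The rest is a frame, and its
  entailments survive the growth of the unrestricted set.\<close>

lemma entails_all_expose:
  assumes "entails_all G D (add_mset A M)"
  obtains G' D' E where "tau_steps (G, D) (G', D' + E)" "G |\<subseteq>| G'"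
    "right_entails G' D' A" "entails_all G' E M"
proof -
  from assms obtain D\<^sub>1 E where D: "D = D\<^sub>1 + E" "entails G D\<^sub>1 A" "entails_all G E M"
    by (rule entails_all_remove)
  from D(2) have "reaches_right G D\<^sub>1 A"
    unfolding entails_def by (rule derivable_reaches_right) simp
  then obtain G' D' where *: "tau_steps (G, D\<^sub>1) (G', D')" "right_entails G' D' A"
    unfolding reaches_right_def by blast
  from tau_steps_unrestricted_mono[OF *(1)] have "G |\<subseteq>| G'" by simp
  with that[of G' D' E] * D tau_steps_add_linear[OF *(1), of E] entails_all_mono
  show ?thesis by blast
qed

section \<open>The candidate simulation and the matching of transitions\<close>

text \<open>Unrestricted formulas must be provable from no linear resources, so that any number of
  copies of them can be matched.\<close>

definition simulates :: "'a state \<Rightarrow> 'a state \<Rightarrow> bool" where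
  "simulates S T \<longleftrightarrow>
    (\<forall>A. A |\<in>| fst S \<longrightarrow> entails (fst T) {#} A) \<and> entails_all (fst T) (snd T) (snd S)"

text \<open>The extra atom idles while the implication is exposed, then joins the part
  \<open>D'\<close>, as the \<open>Lolli\<close> clause of \<open>right_entails\<close>
  asks.\<close>

lemma simulates_recv:
  assumes "step (G\<^sub>1, D\<^sub>1) (Recv a) S" "simulates (G\<^sub>1, D\<^sub>1) (G\<^sub>2, D\<^sub>2)"
  shows "\<exists>T. tau_steps (G\<^sub>2, add_mset (Atom a) D\<^sub>2) T \<and> simulates S T"
  using assms(1)
proof cases
  case (recv B M)
  with assms(2) have "entails_all G\<^sub>2 D\<^sub>2 (add_mset (Lolli a B) M)"
    by (simp add: simulates_def)
  then obtain G' D' E where *: "tau_steps (G\<^sub>2, D\<^sub>2) (G', D' + E)" "G\<^sub>2 |\<subseteq>| G'"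
    "right_entails G' D' (Lolli a B)" "entails_all G' E M"
    by (rule entails_all_expose)
  from *(3,4) have "entails_all G' (add_mset (Atom a) D' + E) (add_mset B M)"
    by (intro entails_all.add) auto
  moreover have "tau_steps (G\<^sub>2, add_mset (Atom a) D\<^sub>2) (G', add_mset (Atom a) D' + E)"
    using tau_steps_add_linear[OF *(1), of "{#Atom a#}"] by simp
  moreover have "\<forall>A. A |\<in>| G\<^sub>1 \<longrightarrow> entails G' {#} A"
    using assms(2) *(2) by (auto simp: simulates_def intro: entails_mono)
  ultimately show ?thesis
    using recv by (intro exI[of _ "(G', add_mset (Atom a) D' + E)"]) (simp add: simulates_def)
qed

text \<open>The state just before the send is provided, so that a communication can hand the atom to
  the receiving part instead of sending it.\<close>

lemma simulates_send:
  assumes "step (G\<^sub>1, D\<^sub>1) (Send a) S" "simulates (G\<^sub>1, D\<^sub>1) (G\<^sub>2, D\<^sub>2)"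
  shows "\<exists>G' E. tau_steps (G\<^sub>2, D\<^sub>2) (G', add_mset (Atom a) E) \<and> simulates S (G', E)"
  using assms(1)
proof cases
  case (send M)
  with assms(2) have "entails_all G\<^sub>2 D\<^sub>2 (add_mset (Atom a) M)"
    by (simp add: simulates_def)
  then obtain G' D' E where *: "tau_steps (G\<^sub>2, D\<^sub>2) (G', D' + E)" "G\<^sub>2 |\<subseteq>| G'"
    "right_entails G' D' (Atom a)" "entails_all G' E M"
    by (rule entails_all_expose)
  have "\<forall>A. A |\<in>| G\<^sub>1 \<longrightarrow> entails G' {#} A"
    using assms(2) *(2) by (auto simp: simulates_def intro: entails_mono)
  with * send show ?thesis
    by (intro exI[of _ G'] exI[of _ E]) (simp add: simulates_def)
qed

lemma simulates_split:
  assumes "simulates (compose S S') (G, D)"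
  shows "\<exists>D\<^sub>1 D\<^sub>2. D = D\<^sub>1 + D\<^sub>2 \<and> simulates S (G, D\<^sub>1) \<and> simulates S' (G, D\<^sub>2)"
  using assms entails_all_split[of G D "snd S" "snd S'"]
  by (auto simp: simulates_def compose_def)

lemma simulates_compose:
  assumes "simulates S (G, D)" "simulates S' (G', D')"
  shows "simulates (compose S S') (G |\<union>| G', D + D')"
proof -
  have add: "entails_all H (D + D') (M + M')"
    if "entails_all H D M" "entails_all H D' M'" for H D D' M M'
    using that by (induction rule: entails_all.induct) (auto simp: ac_simps intro: entails_all.add)
  show ?thesis
    using assms unfolding simulates_def compose_def
    by (auto intro!: add intro: entails_mono entails_all_mono)
qed

lemma simulates_tau:
  assumes "step (G\<^sub>1, D\<^sub>1) Tau S" "simulates (G\<^sub>1, D\<^sub>1) (G\<^sub>2, D\<^sub>2)"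
  shows "\<exists>T. tau_steps (G\<^sub>2, D\<^sub>2) T \<and> simulates S T"
proof -
  \<comment> \<open>Common pattern for transitions that rewrite a single linear formula
    \<open>A\<close>: after exposing it, only its clause of \<open>right_entails\<close> has to be
    used.\<close>
  have decompose: ?thesis
    if D: "D\<^sub>1 = add_mset A M"
      and right: "\<And>G D E. right_entails G D A \<Longrightarrow> entails_all G E M \<Longrightarrow>
        (\<forall>B. B |\<in>| G\<^sub>1 \<longrightarrow> entails G {#} B) \<Longrightarrow> simulates S (G, D + E)" for A M
  proof -
    from D assms(2) have "entails_all G\<^sub>2 D\<^sub>2 (add_mset A M)"
      by (simp add: simulates_def)
    then obtain G' D' E where *: "tau_steps (G\<^sub>2, D\<^sub>2) (G', D' + E)" "G\<^sub>2 |\<subseteq>| G'"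
      "right_entails G' D' A" "entails_all G' E M"
      by (rule entails_all_expose)
    from assms(2) *(2) have "\<forall>B. B |\<in>| G\<^sub>1 \<longrightarrow> entails G' {#} B"
      by (auto simp: simulates_def intro: entails_mono)
    with * right show ?thesis by blast
  qed
  from assms(1) show ?thesis
  proof cases
    case (comm S\<^sub>1 a S\<^sub>1' S\<^sub>2 S\<^sub>2')
    from assms(2) comm(1) obtain E\<^sub>1 E\<^sub>2 where E: "D\<^sub>2 = E\<^sub>1 + E\<^sub>2"
      "simulates S\<^sub>1 (G\<^sub>2, E\<^sub>1)" "simulates S\<^sub>2 (G\<^sub>2, E\<^sub>2)"
      using simulates_split by metis
    obtain G' E' where 1: "tau_steps (G\<^sub>2, E\<^sub>1) (G', add_mset (Atom a) E')"
      "simulates S\<^sub>1' (G', E')"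
      using simulates_send comm(3) E(2) by (metis surj_pair)
    obtain G'' E'' where 2: "tau_steps (G\<^sub>2, add_mset (Atom a) E\<^sub>2) (G'', E'')"
      "simulates S\<^sub>2' (G'', E'')"
      using simulates_recv comm(4) E(3) by (metis surj_pair)
    \<comment> \<open>The sender's part runs first, with \<open>E\<^sub>2\<close> as frame. The atom
      it produces is regrouped with \<open>E\<^sub>2\<close>, giving the linear part that
      \<open>simulates_recv\<close> starts from.\<close>
    have "tau_steps (G\<^sub>2, D\<^sub>2) (G', add_mset (Atom a) E\<^sub>2 + E')"
      using tau_steps_add_linear[OF 1(1), of E\<^sub>2] E(1) by (simp add: ac_simps)
    \<comment> \<open>The receiver's run starts from \<open>G\<^sub>2\<close>; framing it by
      \<open>(G', E')\<close> turns this into \<open>G'\<close>, which contains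
      \<open>G\<^sub>2\<close>.\<close>
    moreover have "tau_steps (G', add_mset (Atom a) E\<^sub>2 + E') (G' |\<union>| G'', E' + E'')"
      using tau_steps_frame[OF 2(1), of "(G', E')"] tau_steps_unrestricted_mono[OF 1(1)]
      by (simp add: compose_def ac_simps sup.absorb1)
    moreover have "simulates S (G' |\<union>| G'', E' + E'')"
      using simulates_compose[OF 1(2) 2(2)] comm(2) by simp
    ultimately show ?thesis
      using tau_steps_trans by blast
  next
    case (tensor A B M)
    show ?thesis
    proof (rule decompose)
      fix G D E
      assume *: "right_entails G D (Tensor A B)" "entails_all G E M"
        "\<forall>B. B |\<in>| G\<^sub>1 \<longrightarrow> entails G {#} B"
      then obtain F\<^sub>1 F\<^sub>2 where F: "D = F\<^sub>1 + F\<^sub>2" "entails G F\<^sub>1 A" "entails G F\<^sub>2 B"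
        by auto
      have "entails_all G (F\<^sub>1 + (F\<^sub>2 + E)) (add_mset A (add_mset B M))"
        by (intro entails_all.add F *)
      with F(1) * tensor show "simulates S (G, D + E)"
        by (simp add: simulates_def ac_simps)
    qed (use tensor in simp)
  next
    case (one M)
    show ?thesis
      by (rule decompose[OF one(1)]) (use one in \<open>auto simp: simulates_def\<close>)
  next
    case (with1 A B M)
    show ?thesis
      by (rule decompose[OF with1(1)])
        (use with1 in \<open>auto simp: simulates_def intro: entails_all.add\<close>)
  next
    case (with2 A B M)
    show ?thesis
      by (rule decompose[OF with2(1)])
        (use with2 in \<open>auto simp: simulates_def intro: entails_all.add\<close>)
  next
    case (bang A M)
    \<comment> \<open>The \<open>Bang\<close> clause gives an empty part and a proof of
      \<open>A\<close> from no linear resources, as \<open>simulates\<close> asks of the new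
      unrestricted formula.\<close>
    show ?thesis
      by (rule decompose[OF bang(1)]) (use bang in \<open>auto simp: simulates_def\<close>)
  next
    case (clone A G)
    \<comment> \<open>The new copy of \<open>A\<close> is assigned the empty part, so the right-hand
      state stays put.\<close>
    then have "simulates S (G\<^sub>2, D\<^sub>2)"
      using assms(2) entails_all.add[of G\<^sub>2 "{#}" A D\<^sub>2 D\<^sub>1] by (simp add: simulates_def)
    then show ?thesis
      using tau_steps_refl by blast
  qed
qed

section \<open>Verification of the simulation conditions and conclusion\<close>

lemma simulation_simulates: "simulation simulates"
  unfolding simulation_def
proof (intro allI impI conjI)
  fix G\<^sub>1 D\<^sub>1 G\<^sub>2 D\<^sub>2
  assume sim: "simulates (G\<^sub>1, D\<^sub>1) (G\<^sub>2, D\<^sub>2 :: 'a fm multiset)"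
  show "\<exists>G\<^sub>2'. weak_step (G\<^sub>2, D\<^sub>2) Tau (G\<^sub>2', {#}) \<and> simulates (G\<^sub>1', {#}) (G\<^sub>2', {#})"
    if "(G\<^sub>1, D\<^sub>1) = (G\<^sub>1', {#})" for G\<^sub>1'
  proof -
    from sim that have "D\<^sub>2 = {#}"
      by (auto simp: simulates_def dest: entails_all_empty)
    with sim that tau_steps_refl show ?thesis
      by (auto simp: weak_step_def)
  qed
  show "\<exists>T T'. weak_step (G\<^sub>2, D\<^sub>2) Tau (compose T T') \<and> simulates S T \<and> simulates S' T'"
    if "(G\<^sub>1, D\<^sub>1) = compose S S'" for S S'
  proof -
    from sim that obtain E\<^sub>1 E\<^sub>2 where E: "D\<^sub>2 = E\<^sub>1 + E\<^sub>2"
      "simulates S (G\<^sub>2, E\<^sub>1)" "simulates S' (G\<^sub>2, E\<^sub>2)"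
      using simulates_split by metis
    \<comment> \<open>Both halves keep the whole of \<open>G\<^sub>2\<close>, so they recompose to
      the original state without any transition.\<close>
    from E(1) have "compose (G\<^sub>2, E\<^sub>1) (G\<^sub>2, E\<^sub>2) = (G\<^sub>2, D\<^sub>2)"
      by (simp add: compose_def)
    with E(2,3) tau_steps_refl show ?thesis
      by (metis weak_step_def)
  qed
  show "\<exists>T. weak_step (G\<^sub>2, D\<^sub>2) \<alpha> T \<and> simulates S T"
    if "\<forall>a. \<alpha> \<noteq> Recv a" "step (G\<^sub>1, D\<^sub>1) \<alpha> S" for \<alpha> S
  proof (cases \<alpha>)
    case Tau
    with that simulates_tau[OF _ sim] show ?thesis
      by (simp add: weak_step_def)
  next
    case (Send a)
    with that simulates_send[OF _ sim] obtain G' E where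
      "tau_steps (G\<^sub>2, D\<^sub>2) (G', add_mset (Atom a) E)" "simulates S (G', E)" by blast
    with Send step.send tau_steps_refl show ?thesis
      unfolding weak_step_def by (metis label.distinct(1))
  next
    case (Recv a)
    with that show ?thesis by blast
  qed
  show "\<exists>T. weak_step (G\<^sub>2, add_mset (Atom a) D\<^sub>2) Tau T \<and> simulates S T"
    if "step (G\<^sub>1, D\<^sub>1) (Recv a) S" for a S
    using simulates_recv[OF that sim] by (simp add: weak_step_def)
qed

theorem theorem2:
  fixes \<Gamma> :: "'a fm fset" and \<Delta> :: "'a fm multiset" and A :: "'a fm"
  assumes "derivable (mset_set (fset \<Gamma>)) \<Delta> A"
  shows "(\<Gamma>, {#A#}) \<preceq>\<^sub>s (\<Gamma>, \<Delta>)"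
proof -
  \<comment> \<open>Both states share \<Gamma>, whose formulas it proves by
    \<open>entails_unrestricted\<close>; all of \<Delta> is the one part, assigned to
    \<open>A\<close>.\<close>
  have "simulates (\<Gamma>, {#A#}) (\<Gamma>, \<Delta>)"
    using assms
    by (simp add: simulates_def entails_unrestricted entails_all_single flip: entails_def)
  then show ?thesis
    unfolding sim_preorder_def using simulation_simulates by blast
qed

end
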